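(* Let $\mathcal H$ be a finite-dimensional complex Hilbert space and $\mathcal H_S\subset\mathcal H$ a proper nonzero subspace. For $x\in\mathbb R^N$ let $H(x)$ be Hermitian and $L_1(x),\dots,L_M(x)\in\mathcal B(\mathcal H)$, where (in a fixed basis) the real and imaginary parts of all matrix entries of $H(x)$ and $L_k(x)$ are polynomial functions of $x$. Consider the Lindblad dynamics $\dot\rho=-i[H(x),\rho]+\sum_{k=1}^M\mathcal D_{L_k(x)}(\rho)$. Assume $\mathcal H_S$ is invariant for this dynamics for every $x\in\mathbb R^N$. If there exists $\bar x\in\mathbb R^N$ for which $\mathcal H_S$ is globally asymptotically stable, then $\mathcal H_S$ is globally asymptotically stable for Lebesgue-almost every $x\in\mathbb R^N$.
   Context: $\mathcal D_L(\rho)=L\rho L^*-\tfrac12(L^*L\rho+\rho L^*L)$. $\mathcal S(\mathcal H)$ denotes the density matrices; $\Pi_0$ is the orthogonal projection onto $\mathcal H_S$ and $\mathbf d_0(\rho)=\|\rho-\Pi_0\rho\Pi_0\|$ (Hilbert–Schmidt norm). $\mathcal H_S$ is invariant if every solution with $\mathrm{Tr}(\Pi_0\rho(0))=1$ satisfies $\mathrm{Tr}(\Pi_0\rho(t))=1$ for all $t\ge0$; it is globally asymptotically stable (GAS) if it is invariant, stable, and $\lim_{t\to\infty}\mathbf d_0(\rho(t))=0$ for every initial state $\rho(0)\in\mathcal S(\mathcal H)$. *)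

theory Defs
  imports "HOL-Analysis.Analysis"
begin

text \<open>Operators on the finite-dimensional Hilbert space \<open>complex ^ 'n\<close> are represented
  as matrices \<open>complex ^ 'n ^ 'n\<close> in the standard basis.  The norm on this type is the
  Euclidean norm of all entries, i.e. the Hilbert--Schmidt norm.\<close>

type_synonym 'n cmat = "complex ^ 'n ^ 'n"

definition adj :: "'n::finite cmat \<Rightarrow> 'n cmat" where
  "adj A = (\<chi> i j. cnj (A $ j $ i))"

definition csmult :: "complex \<Rightarrow> 'n::finite cmat \<Rightarrow> 'n cmat" where
  "csmult c A = (\<chi> i j. c * A $ i $ j)"

definition mtrace :: "'n::finite cmat \<Rightarrow> complex" where
  "mtrace A = (\<Sum>i\<in>UNIV. A $ i $ i)"

definition cinner :: "complex ^ 'n::finite \<Rightarrow> complex ^ 'n \<Rightarrow> complex" where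
  "cinner v w = (\<Sum>i\<in>UNIV. cnj (v $ i) * w $ i)"

definition hermitian :: "'n::finite cmat \<Rightarrow> bool" where
  "hermitian A \<longleftrightarrow> adj A = A"

definition psd :: "'n::finite cmat \<Rightarrow> bool" where
  "psd A \<longleftrightarrow> hermitian A \<and> (\<forall>v. Im (cinner v (A *v v)) = 0 \<and> Re (cinner v (A *v v)) \<ge> 0)"

definition density :: "'n::finite cmat \<Rightarrow> bool" where
  "density \<rho> \<longleftrightarrow> psd \<rho> \<and> mtrace \<rho> = 1"

text \<open>Orthogonal projections (the subspace \<open>\<H>_S\<close> is given by its orthogonal projection \<open>\<Pi>_0\<close>).\<close>
definition orth_proj :: "'n::finite cmat \<Rightarrow> bool" where
  "orth_proj P \<longleftrightarrow> hermitian P \<and> P ** P = P"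

definition dissipator :: "'n::finite cmat \<Rightarrow> 'n cmat \<Rightarrow> 'n cmat" where
  "dissipator L \<rho> = L ** \<rho> ** adj L
     - csmult (1/2) (adj L ** L ** \<rho> + \<rho> ** adj L ** L)"

definition lindblad :: "'n::finite cmat \<Rightarrow> (nat \<Rightarrow> 'n cmat) \<Rightarrow> nat \<Rightarrow> 'n cmat \<Rightarrow> 'n cmat" where
  "lindblad H L M \<rho> = csmult (- \<i>) (H ** \<rho> - \<rho> ** H) + (\<Sum>k<M. dissipator (L k) \<rho>)"

definition is_solution :: "('n::finite cmat \<Rightarrow> 'n cmat) \<Rightarrow> (real \<Rightarrow> 'n cmat) \<Rightarrow> bool" where
  "is_solution G \<rho> \<longleftrightarrow> (\<forall>t\<ge>0. (\<rho> has_vector_derivative G (\<rho> t)) (at t within {0..}))"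

definition dist0 :: "'n::finite cmat \<Rightarrow> 'n cmat \<Rightarrow> real" where
  "dist0 P \<rho> = norm (\<rho> - P ** \<rho> ** P)"

definition invariant :: "'n::finite cmat \<Rightarrow> ('n cmat \<Rightarrow> 'n cmat) \<Rightarrow> bool" where
  "invariant P G \<longleftrightarrow> (\<forall>\<rho>. is_solution G \<rho> \<longrightarrow> density (\<rho> 0) \<longrightarrow> mtrace (P ** \<rho> 0) = 1 \<longrightarrow>
      (\<forall>t\<ge>0. mtrace (P ** \<rho> t) = 1))"

definition stable :: "'n::finite cmat \<Rightarrow> ('n cmat \<Rightarrow> 'n cmat) \<Rightarrow> bool" where
  "stable P G \<longleftrightarrow> (\<forall>\<epsilon>>0. \<exists>\<delta>>0. \<forall>\<rho>. is_solution G \<rho> \<longrightarrow> density (\<rho> 0) \<longrightarrow>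
      dist0 P (\<rho> 0) < \<delta> \<longrightarrow> (\<forall>t\<ge>0. dist0 P (\<rho> t) < \<epsilon>))"

definition GAS :: "'n::finite cmat \<Rightarrow> ('n cmat \<Rightarrow> 'n cmat) \<Rightarrow> bool" where
  "GAS P G \<longleftrightarrow> invariant P G \<and> stable P G \<and>
     (\<forall>\<rho>. is_solution G \<rho> \<longrightarrow> density (\<rho> 0) \<longrightarrow> ((\<lambda>t. dist0 P (\<rho> t)) \<longlongrightarrow> 0) at_top)"

inductive polyfun :: "(real ^ 'N \<Rightarrow> real) \<Rightarrow> bool" where
  const: "polyfun (\<lambda>x. c)"
| coord: "polyfun (\<lambda>x. x $ i)"
| add: "polyfun f \<Longrightarrow> polyfun g \<Longrightarrow> polyfun (\<lambda>x. f x + g x)"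
| mult: "polyfun f \<Longrightarrow> polyfun g \<Longrightarrow> polyfun (\<lambda>x. f x * g x)"

definition poly_matrix_fun :: "(real ^ 'N \<Rightarrow> 'n::finite cmat) \<Rightarrow> bool" where
  "poly_matrix_fun F \<longleftrightarrow> (\<forall>i j. polyfun (\<lambda>x. Re (F x $ i $ j)) \<and> polyfun (\<lambda>x. Im (F x $ i $ j)))"

end

theory Submission
  imports Defs "HOL-Computational_Algebra.Polynomial"
begin

text \<open>Write \<open>Q = 1 - \<Pi>\<^sub>0\<close>, let \<open>G\<close> be the generator and call \<open>q = tr (Q \<rho>)\<close> the leakage of a state
  \<open>\<rho>\<close>; it controls the distance to the target and is controlled by it. Invariance makes the block
  \<open>Q \<rho> Q\<close> evolve autonomously under the compression \<open>X \<mapsto> Q G(X) Q\<close>, and positivity makes the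
  leakage nonincreasing along solutions. Global asymptotic stability is then equivalent to
  injectivity of the compression on the \<open>Q\<close>-block. If the target is stable, the \<open>Q\<close>-block of every
  matrix decays under the flow, because the density matrices span, whereas a kernel element is a
  stationary block. Conversely, an inverse of the compression gives a bounded function whose
  derivative is \<open>q\<close>, so that \<open>q(t) = O(1/t)\<close>. Injectivity is the nonvanishing of a determinant,
  which is polynomial in the parameter, and a polynomial that is nonzero at one point vanishes
  only on a null set.\<close>

section \<open>Matrix algebra\<close>

interpretation matrix_mult: bounded_bilinear
  "(**) :: 'a::{euclidean_space, real_algebra_1} ^ 'n::finite ^ 'm::finite
    \<Rightarrow> 'a ^ 'p::finite ^ 'n \<Rightarrow> 'a ^ 'p ^ 'm"
  unfolding bilinear_conv_bounded_bilinear[symmetric] bilinear_def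
  by (auto intro!: linearI
      simp: vec_eq_iff matrix_matrix_mult_def distrib_left distrib_right sum.distrib
        scaleR_sum_right)

interpretation matrix_vector_mult: bounded_bilinear
  "(*v) :: 'a::{euclidean_space, real_algebra_1} ^ 'n::finite ^ 'm::finite \<Rightarrow> 'a ^ 'n \<Rightarrow> 'a ^ 'm"
  unfolding bilinear_conv_bounded_bilinear[symmetric] bilinear_def
  by (auto intro!: linearI
      simp: vec_eq_iff matrix_vector_mult_def distrib_left distrib_right sum.distrib
        scaleR_sum_right)

lemmas matrix_mult_linear_simps =
  matrix_mult.add_left matrix_mult.add_right matrix_mult.diff_left matrix_mult.diff_right
  matrix_mult.scaleR_left matrix_mult.scaleR_right matrix_mult.sum_left matrix_mult.sum_right

lemma adj_nth [simp]: "adj A $ i $ j = cnj (A $ j $ i)"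
  by (simp add: adj_def)

lemma csmult_nth [simp]: "csmult c A $ i $ j = c * A $ i $ j"
  by (simp add: csmult_def)

lemma linear_adj: "linear (adj :: 'n::finite cmat \<Rightarrow> 'n cmat)"
  by (rule linearI) (simp_all add: vec_eq_iff)

lemmas adj_add = linear_add[OF linear_adj]
  and adj_diff = linear_diff[OF linear_adj]
  and adj_scaleR = linear_scale[OF linear_adj]
  and adj_sum = linear_sum[OF linear_adj]
  and adj_zero [simp] = linear_0[OF linear_adj]

lemma linear_csmult: "linear (csmult c :: 'n::finite cmat \<Rightarrow> 'n cmat)"
  by (rule linearI) (simp_all add: vec_eq_iff distrib_left)

lemmas csmult_add = linear_add[OF linear_csmult]
  and csmult_diff = linear_diff[OF linear_csmult]
  and csmult_sum = linear_sum[OF linear_csmult]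

lemma linear_mtrace: "linear (mtrace :: 'n::finite cmat \<Rightarrow> complex)"
  by (rule linearI) (simp_all add: mtrace_def sum.distrib scaleR_sum_right)

lemmas mtrace_add = linear_add[OF linear_mtrace]
  and mtrace_diff = linear_diff[OF linear_mtrace]
  and mtrace_scaleR = linear_scale[OF linear_mtrace]
  and mtrace_sum = linear_sum[OF linear_mtrace]
  and mtrace_zero = linear_0[OF linear_mtrace]

lemma adj_adj [simp]: "adj (adj A) = A"
  by (simp add: vec_eq_iff)

lemma adj_mat_1 [simp]: "adj (mat 1) = mat 1"
  by (simp add: vec_eq_iff mat_def)

lemma adj_mult: "adj (A ** B) = adj B ** adj A"
  by (simp add: vec_eq_iff matrix_matrix_mult_def mult.commute)

lemma adj_csmult: "adj (csmult c A) = csmult (cnj c) (adj A)"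
  by (simp add: vec_eq_iff)

lemma csmult_mult_left: "csmult c A ** B = csmult c (A ** B)"
  by (simp add: vec_eq_iff matrix_matrix_mult_def sum_distrib_left mult.assoc)

lemma csmult_mult_right: "A ** csmult c B = csmult c (A ** B)"
  by (simp add: vec_eq_iff matrix_matrix_mult_def sum_distrib_left mult.left_commute)

lemma csmult_of_real: "csmult (of_real r) A = r *\<^sub>R A"
  by (simp add: vec_eq_iff) (simp add: scaleR_conv_of_real)

lemma mtrace_mult_commute: "mtrace (A ** B) = mtrace (B ** A)"
  using trace_mul_sym[of A B] by (simp add: mtrace_def trace_def)

lemma norm_cmat_power2: "(norm (A :: 'n::finite cmat))\<^sup>2 = (\<Sum>i\<in>UNIV. \<Sum>j\<in>UNIV. (cmod (A $ i $ j))\<^sup>2)"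
  by (simp add: norm_vec_def L2_set_def sum_nonneg)

lemma mtrace_mult_adj: "mtrace (A ** adj A) = of_real ((norm A)\<^sup>2)"
  by (simp add: norm_cmat_power2 mtrace_def matrix_matrix_mult_def complex_norm_square
      del: of_real_power)

section \<open>Positive semidefinite matrices\<close>

lemma Re_cinner: "Re (cinner v w) = v \<bullet> w"
  by (simp add: cinner_def inner_vec_def inner_complex_def)

lemma cinner_adj: "cinner v (A *v w) = cinner (adj A *v v) w"
  unfolding cinner_def matrix_vector_mult_def
  by (simp add: sum_distrib_left sum_distrib_right, subst sum.swap, simp add: ac_simps)

lemma inner_adj: "v \<bullet> (A *v w) = (adj A *v v) \<bullet> (w :: complex ^ 'n::finite)"
  using cinner_adj[of v A w] by (metis Re_cinner)

lemma cnj_cinner: "cnj (cinner v w) = cinner w v"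
  by (simp add: cinner_def mult.commute)

lemma cinner_hermitian_real:
  assumes "hermitian A"
  shows "Im (cinner v (A *v v)) = 0"
proof -
  have "cnj (cinner v (A *v v)) = cinner v (A *v v)"
    using assms cinner_adj[of v A v] by (simp add: cnj_cinner hermitian_def)
  then show ?thesis
    by (metis Reals_cnj_iff complex_is_Real_iff)
qed

lemma psd_iff: "psd A \<longleftrightarrow> hermitian A \<and> (\<forall>v. 0 \<le> v \<bullet> (A *v v))"
  using cinner_hermitian_real by (auto simp: psd_def Re_cinner)

lemma psd_add: "psd A \<Longrightarrow> psd B \<Longrightarrow> psd (A + B)"
  by (simp add: psd_iff hermitian_def adj_add matrix_vector_mult.add_left inner_add_right)

lemma psd_scaleR: "psd A \<Longrightarrow> 0 \<le> r \<Longrightarrow> psd (r *\<^sub>R A)"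
  by (simp add: psd_iff hermitian_def adj_scaleR matrix_vector_mult.scaleR_left)

lemma psd_zero: "psd 0"
  by (simp add: psd_iff hermitian_def adj_zero)

lemma psd_sum: "(\<And>k. k \<in> I \<Longrightarrow> psd (A k)) \<Longrightarrow> psd (\<Sum>k\<in>I. A k)"
  by (induction I rule: infinite_finite_induct) (simp_all add: psd_zero psd_add)

lemma psd_mat_1: "psd (mat 1)"
  by (simp add: psd_iff hermitian_def)

lemma psd_sandwich: "psd X \<Longrightarrow> psd (A ** X ** adj A)"
  using inner_adj[where A = A]
  by (simp add: psd_iff hermitian_def adj_mult matrix_mul_assoc
      flip: matrix_vector_mul_assoc)

lemma convex_psd: "convex {A. psd A}"
  by (auto intro!: convexI psd_add psd_scaleR)

lemma closed_psd: "closed {A :: 'n::finite cmat. psd A}"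
proof -
  have "linear (\<lambda>A :: 'n cmat. v \<bullet> (A *v v))" for v
    by (rule linearI)
      (simp_all add: matrix_vector_mult.add_left matrix_vector_mult.scaleR_left inner_add_right)
  then have "closed {A :: 'n cmat. 0 \<le> v \<bullet> (A *v v)}" for v
    by (intro closed_Collect_le continuous_on_const linear_continuous_on)
      (simp add: linear_conv_bounded_linear)
  moreover have "closed {A :: 'n cmat. adj A = A}"
    by (intro closed_Collect_eq continuous_on_id linear_continuous_on
        linear_conv_bounded_linear[THEN iffD1] linear_adj)
  ultimately show ?thesis
    unfolding psd_iff hermitian_def by (intro closed_Collect_conj closed_Collect_all)
qed

lemma quadratic_nonneg_imp_discriminant:
  fixes a b c :: real
  assumes nonneg: "\<And>s. 0 \<le> a + 2 * s * b + s\<^sup>2 * c" and "0 \<le> c"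
  shows "b\<^sup>2 \<le> a * c"
proof (cases "c = 0")
  case True
  have "b = 0"
  proof (rule ccontr)
    assume "b \<noteq> 0"
    then show False
      using nonneg[of "- (a + 1) / (2 * b)"] True by (simp add: field_simps)
  qed
  then show ?thesis
    using True by simp
next
  case False
  then show ?thesis
    using nonneg[of "- b / c"] \<open>0 \<le> c\<close> by (simp add: field_simps power2_eq_square)
qed

lemma psd_inner_Cauchy_Schwarz:
  fixes X :: "'n::finite cmat"
  assumes "psd X"
  shows "(v \<bullet> (X *v w))\<^sup>2 \<le> (v \<bullet> (X *v v)) * (w \<bullet> (X *v w))"
proof (rule quadratic_nonneg_imp_discriminant)
  show "0 \<le> v \<bullet> (X *v v) + 2 * s * (v \<bullet> (X *v w)) + s\<^sup>2 * (w \<bullet> (X *v w))" for s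
  proof -
    have "w \<bullet> (X *v v) = v \<bullet> (X *v w)"
      using assms inner_adj[of w X v] by (simp add: psd_iff hermitian_def inner_commute)
    then have "(v + s *\<^sub>R w) \<bullet> (X *v (v + s *\<^sub>R w))
        = v \<bullet> (X *v v) + 2 * s * (v \<bullet> (X *v w)) + s\<^sup>2 * (w \<bullet> (X *v w))"
      by (simp add: matrix_vector_mult.scaleR_right algebra_simps inner_add_left
          inner_add_right power2_eq_square)
    then show ?thesis
      using assms by (metis psd_iff)
  qed
  show "0 \<le> w \<bullet> (X *v w)"
    using assms by (simp add: psd_iff)
qed

text \<open>Multiplying \<open>v\<close> by \<open>z = \<langle>v, X w\<rangle>\<close> makes the product real, which reduces the complex inequality
  to the real one.\<close>

lemma psd_cinner_Cauchy_Schwarz: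
  assumes "psd X"
  shows "(cmod (cinner v (X *v w)))\<^sup>2 \<le> (v \<bullet> (X *v v)) * (w \<bullet> (X *v w))"
proof (cases "cinner v (X *v w) = 0")
  case True
  then show ?thesis
    using assms by (simp add: psd_iff)
next
  case False
  define z where "z = cinner v (X *v w)"
  have "cinner (z *s v) u = cnj z * cinner v u" for u
    by (simp add: cinner_def sum_distrib_left mult.assoc)
  moreover have "cinner v (X *v (z *s v)) = z * cinner v (X *v v)"
    by (simp add: vector_scalar_commute) (simp add: cinner_def sum_distrib_left mult.left_commute)
  moreover have "cnj z * z = of_real ((cmod z)\<^sup>2)"
    by (metis complex_norm_square mult.commute)
  ultimately have "(z *s v) \<bullet> (X *v w) = (cmod z)\<^sup>2"
    and "(z *s v) \<bullet> (X *v (z *s v)) = (cmod z)\<^sup>2 * (v \<bullet> (X *v v))"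
    by (simp_all add: z_def flip: Re_cinner mult.assoc del: of_real_power)
  then have "(cmod z)\<^sup>2 * (cmod z)\<^sup>2 \<le> (cmod z)\<^sup>2 * ((v \<bullet> (X *v v)) * (w \<bullet> (X *v w)))"
    using psd_inner_Cauchy_Schwarz[OF assms, of "z *s v" w]
    by (simp add: power2_eq_square mult.assoc)
  moreover have "0 < (cmod z)\<^sup>2"
    using False by (simp add: z_def)
  ultimately show ?thesis
    unfolding z_def[symmetric] by (rule mult_left_le_imp_le)
qed

lemma nth_nth_eq_cinner: "A $ i $ j = cinner (axis i 1) (A *v axis j 1)"
  by (simp add: cinner_def axis_def matrix_vector_mult_def if_distrib if_distribR cong: if_cong)

lemma Re_mtrace: "Re (mtrace A) = (\<Sum>i\<in>UNIV. axis i 1 \<bullet> (A *v axis i 1))"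
  by (simp add: mtrace_def nth_nth_eq_cinner Re_cinner)

lemma Re_mtrace_sandwich: "Re (mtrace (A ** X ** adj A))
    = (\<Sum>i\<in>UNIV. (adj A *v axis i 1) \<bullet> (X *v (adj A *v axis i 1)))"
  by (simp add: Re_mtrace inner_adj[where A = A] flip: matrix_vector_mul_assoc)

lemma psd_mtrace_nonneg: "psd A \<Longrightarrow> 0 \<le> Re (mtrace A)"
  by (simp add: Re_mtrace psd_iff sum_nonneg)

lemma psd_mtrace_eq_Re: "psd A \<Longrightarrow> mtrace A = of_real (Re (mtrace A))"
  by (simp add: complex_eq_iff mtrace_def nth_nth_eq_cinner cinner_hermitian_real psd_iff)

lemma psd_norm_sandwich_le:
  assumes "psd X"
  shows "(norm (A ** X ** adj B))\<^sup>2 \<le> Re (mtrace (A ** X ** adj A)) * Re (mtrace (B ** X ** adj B))"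
proof -
  let ?a = "\<lambda>i. adj A *v axis i 1" and ?b = "\<lambda>j. adj B *v axis j 1"
  have "(A ** X ** adj B) $ i $ j = cinner (?a i) (X *v ?b j)" for i j
    by (simp add: nth_nth_eq_cinner cinner_adj[symmetric] flip: matrix_vector_mul_assoc)
  then have "(norm (A ** X ** adj B))\<^sup>2
      \<le> (\<Sum>i\<in>UNIV. \<Sum>j\<in>UNIV. (?a i \<bullet> (X *v ?a i)) * (?b j \<bullet> (X *v ?b j)))"
    unfolding norm_cmat_power2 by (simp only:) (intro sum_mono psd_cinner_Cauchy_Schwarz assms)
  then show ?thesis
    by (simp add: Re_mtrace_sandwich sum_product)
qed

lemma psd_norm_le_mtrace:
  assumes "psd X"
  shows "norm X \<le> Re (mtrace X)"
proof (rule power2_le_imp_le)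
  show "(norm X)\<^sup>2 \<le> (Re (mtrace X))\<^sup>2"
    using psd_norm_sandwich_le[OF assms, of "mat 1" "mat 1"] by (simp add: power2_eq_square)
qed (rule psd_mtrace_nonneg[OF assms])

lemma density_norm_le_1: "density X \<Longrightarrow> norm X \<le> 1"
  using psd_norm_le_mtrace[of X] by (simp add: density_def)

lemma density_normalize:
  assumes "psd X" "X \<noteq> 0"
  shows "0 < Re (mtrace X)" and "density (X /\<^sub>R Re (mtrace X))"
proof -
  show pos: "0 < Re (mtrace X)"
    using psd_norm_le_mtrace[OF assms(1)] assms(2) by (meson less_le_trans zero_less_norm_iff)
  have "mtrace (X /\<^sub>R Re (mtrace X)) = of_real (Re (mtrace X) / Re (mtrace X))"
    using psd_mtrace_eq_Re[OF assms(1)]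
    by (metis (no_types) divide_inverse mtrace_scaleR mult.commute of_real_mult scaleR_conv_of_real)
  then show "density (X /\<^sub>R Re (mtrace X))"
    using pos assms(1) by (simp add: density_def psd_scaleR)
qed

lemma hermitian_shift_psd:
  fixes A :: "'n::finite cmat"
  assumes "hermitian A"
  obtains c where "0 \<le> c" "psd (c *\<^sub>R mat 1 + A)"
proof -
  obtain B where B: "0 < B" "\<And>v. norm (A *v v) \<le> norm v * B"
    using bounded_linear.pos_bounded[OF matrix_vector_mul_bounded_linear[of A]] by blast
  have "0 \<le> v \<bullet> ((B *\<^sub>R mat 1 + A) *v v)" for v
  proof -
    have "\<bar>v \<bullet> (A *v v)\<bar> \<le> norm v * (norm v * B)"
      by (rule order_trans[OF Cauchy_Schwarz_ineq2 mult_left_mono[OF B(2)]]) simp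
    then show ?thesis
      by (simp add: matrix_vector_mult.add_left matrix_vector_mult.scaleR_left inner_add_right
          power2_norm_eq_inner[symmetric] power2_eq_square mult_ac)
  qed
  then have "psd (B *\<^sub>R mat 1 + A)"
    using assms by (simp add: psd_iff hermitian_def adj_add adj_scaleR)
  then show ?thesis
    using that B(1) by (meson less_imp_le)
qed

lemma cmat_Cartesian_decomposition:
  fixes X :: "'n::finite cmat"
  obtains A B where "hermitian A" "hermitian B" "X = A + csmult \<i> B"
proof
  show "hermitian (csmult (1 / 2) (X + adj X))" "hermitian (csmult (\<i> / 2) (adj X - X))"
    by (simp_all add: hermitian_def vec_eq_iff algebra_simps)
  show "X = csmult (1 / 2) (X + adj X) + csmult \<i> (csmult (\<i> / 2) (adj X - X))"
    by (simp add: vec_eq_iff complex_eq_iff flip: add_divide_distrib)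
qed

lemma density_span_induct:
  fixes X :: "'n::finite cmat"
  assumes density: "\<And>X. density X \<Longrightarrow> V X"
    and add: "\<And>X Y. V X \<Longrightarrow> V Y \<Longrightarrow> V (X + Y)"
    and csmult: "\<And>c X. V X \<Longrightarrow> V (csmult c X)"
  shows "V X"
proof -
  have scaleR: "V (r *\<^sub>R Y)" if "V Y" for r Y
    using csmult[OF that, of "of_real r"] by (simp add: csmult_of_real)
  have psd: "V Y" if "psd Y" "Y \<noteq> 0" for Y
    using scaleR[OF density[OF density_normalize(2)[OF that]], of "Re (mtrace Y)"]
      density_normalize(1)[OF that] by simp
  have "(mat 1 :: 'n cmat) \<noteq> 0"
    by (simp add: vec_eq_iff mat_def)
  then have one: "V (mat 1)"
    by (rule psd[OF psd_mat_1])
  have zero: "V 0"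
    using scaleR[OF one, of 0] by simp
  have hermitian: "V A" if A: "hermitian A" for A
  proof -
    obtain c where "psd (c *\<^sub>R mat 1 + A)"
      using hermitian_shift_psd[OF A] .
    then have "V (c *\<^sub>R mat 1 + A)"
      using psd zero by (cases "c *\<^sub>R mat 1 + A = 0") auto
    then show ?thesis
      using add[OF _ scaleR[OF one, of "- c"]] by fastforce
  qed
  obtain A B where "hermitian A" "hermitian B" "X = A + csmult \<i> B"
    by (rule cmat_Cartesian_decomposition)
  then show ?thesis
    by (simp add: add csmult hermitian)
qed

section \<open>Linear differential equations\<close>

lemma has_vector_derivative_linear:
  fixes F :: "'a::euclidean_space \<Rightarrow> 'b::real_normed_vector"
  assumes "linear F" "(f has_vector_derivative f') net"
  shows "((\<lambda>t. F (f t)) has_vector_derivative F f') net"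
  using assms by (simp add: bounded_linear.has_vector_derivative linear_conv_bounded_linear)

lemma deriv_nonpos_imp_le:
  fixes f :: "real \<Rightarrow> real"
  assumes "s \<le> t"
    and deriv: "\<And>x. s \<le> x \<Longrightarrow> x \<le> t \<Longrightarrow> (f has_real_derivative f' x) (at x within {s..t})"
    and nonpos: "\<And>x. s < x \<Longrightarrow> x < t \<Longrightarrow> f' x \<le> 0"
  shows "f t \<le> f s"
proof (cases "s = t")
  case False
  then have "\<exists>x\<in>{s<..<t}. f t - f s = f' x * (t - s)"
    using assms(1) deriv by (intro mvt_simple) (auto simp: has_field_derivative_def)
  then show ?thesis
    using nonpos assms(1) mult_nonpos_nonneg[of "f' _" "t - s"] by fastforce
qed simp

lemma gronwall_nonpos:
  fixes f :: "real \<Rightarrow> real"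
  assumes deriv: "\<And>s. 0 \<le> s \<Longrightarrow> (f has_real_derivative f' s) (at s within {0..})"
    and bound: "\<And>s. 0 \<le> s \<Longrightarrow> f' s \<le> B * f s"
    and "f 0 \<le> 0" "0 \<le> t"
  shows "f t \<le> 0"
proof -
  have "exp (- B * t) * f t \<le> exp (- B * 0) * f 0"
  proof (rule deriv_nonpos_imp_le[OF \<open>0 \<le> t\<close>])
    fix s :: real assume "0 \<le> s"
    then have "((\<lambda>s. exp (- B * s) * f s) has_real_derivative exp (- B * s) * (f' s - B * f s))
        (at s within {0..})"
      by (auto intro!: derivative_eq_intros deriv simp: algebra_simps)
    then show "((\<lambda>s. exp (- B * s) * f s) has_real_derivative exp (- B * s) * (f' s - B * f s))
        (at s within {0..t})"
      by (rule DERIV_subset) auto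
  next
    show "exp (- B * s) * (f' s - B * f s) \<le> 0" if "0 < s" for s
      using bound[of s] that by (simp add: mult_le_0_iff)
  qed
  then have "exp (- B * t) * f t \<le> 0"
    using \<open>f 0 \<le> 0\<close> by simp
  then show ?thesis
    by (simp add: mult_le_0_iff)
qed

lemma dist_closest_point_squared_le:
  fixes C :: "'a::euclidean_space set"
  assumes "closed C" "C \<noteq> {}"
  shows "(norm (y - closest_point C y))\<^sup>2 \<le> (norm (x - closest_point C x))\<^sup>2
    + 2 * ((x - closest_point C x) \<bullet> (y - x)) + (norm (y - x))\<^sup>2"
proof -
  define r where "r = x - closest_point C x"
  have "norm (y - closest_point C y) \<le> norm (r + (y - x))"
    using closest_point_le[OF assms(1) closest_point_in_set[OF assms], of y x]
    by (simp add: r_def dist_norm)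
  then have "(norm (y - closest_point C y))\<^sup>2 \<le> (norm (r + (y - x)))\<^sup>2"
    by (rule power_mono) simp
  then show ?thesis
    unfolding r_def[symmetric]
    by (simp add: power2_norm_eq_inner inner_add_left inner_add_right inner_commute)
qed

lemma has_derivative_dist_closest_point_squared:
  fixes C :: "'a::euclidean_space set"
  assumes "convex C" "closed C" "C \<noteq> {}"
  shows "((\<lambda>x. (norm (x - closest_point C x))\<^sup>2) has_derivative
    (\<lambda>h. 2 * ((x - closest_point C x) \<bullet> h))) (at x)"
proof -
  define r where "r = (\<lambda>x. x - closest_point C x)"
  have "\<bar>(norm (r y))\<^sup>2 - (norm (r x))\<^sup>2 - 2 * (r x \<bullet> (y - x))\<bar> \<le> 5 * (norm (y - x))\<^sup>2" for y
  proof -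
    have "norm (r x - r y) \<le> 2 * norm (y - x)"
      using closest_point_lipschitz[OF assms, of y x]
        norm_triangle_ineq4[of "x - y" "closest_point C x - closest_point C y"]
      by (simp add: r_def dist_norm norm_minus_commute algebra_simps)
    then have "(r x - r y) \<bullet> (y - x) \<le> 2 * norm (y - x) * norm (y - x)"
      using norm_cauchy_schwarz[of "r x - r y" "y - x"]
      by (meson mult_right_mono norm_ge_zero order_trans)
    then show ?thesis
      using dist_closest_point_squared_le[OF assms(2,3), of x y]
        dist_closest_point_squared_le[OF assms(2,3), of y x]
      by (simp add: inner_diff_left inner_diff_right norm_minus_commute power2_eq_square
          abs_le_iff r_def)
  qed
  then have "norm ((norm (r y))\<^sup>2 - (norm (r x))\<^sup>2 - 2 * (r x \<bullet> (y - x))) / norm (y - x)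
      \<le> 5 * norm (y - x)" if "y \<noteq> x" for y
    using that by (simp add: divide_le_eq power2_eq_square mult.assoc)
  moreover have "((\<lambda>y. 5 * norm (y - x)) \<longlongrightarrow> 0) (at x)"
    by (auto intro!: tendsto_eq_intros)
  moreover have "bounded_linear (\<lambda>h. 2 * (r x \<bullet> h))"
    by (intro bounded_linear_intros)
  ultimately have "((\<lambda>x. (norm (r x))\<^sup>2) has_derivative (\<lambda>h. 2 * (r x \<bullet> h))) (at x)"
    by (intro has_derivativeI_sandwich[of 1]) auto
  then show ?thesis
    by (simp add: r_def)
qed

text \<open>Nagumo's theorem: the squared distance \<open>f\<close> to the closed convex set satisfies \<open>f' \<le> 2 B f\<close>.\<close>

lemma closed_convex_forward_invariant:
  fixes y :: "real \<Rightarrow> 'a::euclidean_space"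
  assumes C: "convex C" "closed C" and lipschitz: "B-lipschitz_on UNIV G"
    and subtangential: "\<And>p n. p \<in> C \<Longrightarrow> (\<And>z. z \<in> C \<Longrightarrow> n \<bullet> (z - p) \<le> 0) \<Longrightarrow> n \<bullet> G p \<le> 0"
    and y: "\<And>s. 0 \<le> s \<Longrightarrow> (y has_vector_derivative G (y s)) (at s within {0..})"
    and "y 0 \<in> C" "0 \<le> t"
  shows "y t \<in> C"
proof -
  have nonempty: "C \<noteq> {}"
    using \<open>y 0 \<in> C\<close> by blast
  define p where "p = (\<lambda>s. closest_point C (y s))"
  have "(norm (y t - p t))\<^sup>2 \<le> 0"
  proof (rule gronwall_nonpos[OF _ _ _ \<open>0 \<le> t\<close>])
    fix s :: real assume "0 \<le> s"
    have "((\<lambda>x. (norm (x - closest_point C x))\<^sup>2) has_derivative (\<lambda>h. 2 * ((y s - p s) \<bullet> h)))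
        (at (y s) within y ` {0..})"
      unfolding p_def
      by (rule has_derivative_at_withinI)
        (rule has_derivative_dist_closest_point_squared[OF C nonempty])
    from vector_derivative_diff_chain_within[OF y[OF \<open>0 \<le> s\<close>] this]
    show "((\<lambda>s. (norm (y s - p s))\<^sup>2) has_real_derivative 2 * ((y s - p s) \<bullet> G (y s)))
        (at s within {0..})"
      by (simp add: has_real_derivative_iff_has_vector_derivative o_def p_def)
    have "(y s - p s) \<bullet> G (p s) \<le> 0"
      unfolding p_def by (intro subtangential closest_point_in_set closest_point_dot C nonempty)
    moreover have "(y s - p s) \<bullet> (G (y s) - G (p s)) \<le> norm (y s - p s) * (B * norm (y s - p s))"
      using lipschitz_onD[OF lipschitz, of "y s" "p s"]
      by (intro order_trans[OF norm_cauchy_schwarz] mult_left_mono) (auto simp: dist_norm)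
    ultimately show "2 * ((y s - p s) \<bullet> G (y s)) \<le> 2 * B * (norm (y s - p s))\<^sup>2"
      by (simp add: inner_diff_right power2_eq_square algebra_simps)
  next
    show "(norm (y 0 - p 0))\<^sup>2 \<le> 0"
      using \<open>y 0 \<in> C\<close> by (simp add: p_def closest_point_self)
  qed
  then have "p t = y t"
    by simp
  then show ?thesis
    using closest_point_refl[OF C(2) nonempty] by (simp add: p_def)
qed

definition linear_flow :: "('a::real_normed_vector \<Rightarrow> 'a) \<Rightarrow> real \<Rightarrow> 'a \<Rightarrow> 'a" where
  "linear_flow G t X = (\<Sum>n. (t ^ n / fact n) *\<^sub>R (G ^^ n) X)"

lemma linear_flow_0: "linear_flow G 0 X = X"
  using suminf_finite[of "{0}" "\<lambda>n. (0 ^ n / fact n) *\<^sub>R (G ^^ n) X"] by (simp add: linear_flow_def)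

lemma norm_funpow_le:
  fixes G :: "'a::real_normed_vector \<Rightarrow> 'a"
  assumes "\<And>v. norm (G v) \<le> norm v * B" "0 \<le> B"
  shows "norm ((G ^^ n) X) \<le> norm X * B ^ n"
proof (induction n)
  case (Suc n)
  have "norm ((G ^^ Suc n) X) \<le> norm ((G ^^ n) X) * B"
    using assms(1) by simp
  also have "\<dots> \<le> norm X * B ^ n * B"
    using Suc assms(2) by (intro mult_right_mono)
  finally show ?case
    by (simp add: mult_ac)
qed simp

lemma summable_linear_flow:
  fixes G :: "'a::banach \<Rightarrow> 'a"
  assumes "bounded_linear G"
  shows "summable (\<lambda>n. (t ^ n / fact n) *\<^sub>R (G ^^ n) X)"
proof -
  obtain B where B: "0 < B" "\<And>v. norm (G v) \<le> norm v * B"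
    using bounded_linear.pos_bounded[OF assms] by blast
  have "norm ((t ^ n / fact n) *\<^sub>R (G ^^ n) X) \<le> norm X * (inverse (fact n) * (\<bar>t\<bar> * B) ^ n)" for n
    using mult_left_mono[OF norm_funpow_le[OF B(2), of n X], of "\<bar>t\<bar> ^ n / fact n"] B(1)
    by (simp add: power_abs power_mult_distrib divide_inverse abs_mult mult_ac)
  moreover have "summable (\<lambda>n. norm X * (inverse (fact n) * (\<bar>t\<bar> * B) ^ n))"
    using summable_exp_generic[of "\<bar>t\<bar> * B"] by (intro summable_mult) (simp add: mult.commute)
  ultimately show ?thesis
    by (rule summable_comparison_test'[rotated])
qed

lemma linear_flow_map:
  fixes F :: "'a::banach \<Rightarrow> 'b::banach"
  assumes "bounded_linear F" "bounded_linear G"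
  shows "F (linear_flow G t X) = (\<Sum>n. (t ^ n / fact n) *\<^sub>R F ((G ^^ n) X))"
  using bounded_linear.suminf[OF assms(1) summable_linear_flow[OF assms(2)]]
    linear_scale[OF bounded_linear.linear[OF assms(1)]]
  by (simp add: linear_flow_def)

lemma linear_flow_commute:
  fixes G :: "'a::banach \<Rightarrow> 'a"
  assumes "bounded_linear F" "bounded_linear G" and commute: "\<And>Y. F (G Y) = G (F Y)"
  shows "F (linear_flow G t X) = linear_flow G t (F X)"
proof -
  have "F ((G ^^ n) X) = (G ^^ n) (F X)" for n
    by (induction n) (simp_all add: commute)
  then show ?thesis
    unfolding linear_flow_map[OF assms(1,2)] by (simp add: linear_flow_def)
qed

lemma linear_flow_add:
  fixes G :: "'a::banach \<Rightarrow> 'a"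
  assumes "bounded_linear G"
  shows "linear_flow G t (X + Y) = linear_flow G t X + linear_flow G t Y"
proof -
  have "(G ^^ n) (X + Y) = (G ^^ n) X + (G ^^ n) Y" for n
    by (induction n) (simp_all add: linear_add[OF bounded_linear.linear[OF assms]])
  then show ?thesis
    using suminf_add[OF summable_linear_flow[OF assms] summable_linear_flow[OF assms], of t X t Y]
    by (simp add: linear_flow_def scaleR_right_distrib)
qed

lemma linear_flow_has_vector_derivative:
  fixes G :: "'a::euclidean_space \<Rightarrow> 'a"
  assumes "bounded_linear G"
  shows "((\<lambda>t. linear_flow G t X) has_vector_derivative G (linear_flow G t X)) (at t)"
proof -
  have "((\<lambda>t. linear_flow G t X \<bullet> b) has_vector_derivative linear_flow G t (G X) \<bullet> b) (at t)" for b
  proof -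
    define c where "c = (\<lambda>n. (G ^^ n) X \<bullet> b / fact n)"
    have series: "linear_flow G s Y \<bullet> b = (\<Sum>n. (G ^^ n) Y \<bullet> b / fact n * s ^ n)" for s Y
      using linear_flow_map[OF bounded_linear_inner_left assms] by (simp add: mult.commute)
    have "summable (\<lambda>n. c n * s ^ n)" for s
      using bounded_linear.summable[OF bounded_linear_inner_left summable_linear_flow[OF assms],
          of s X b]
      by (simp add: c_def mult.commute)
    then have "((\<lambda>s. \<Sum>n. c n * s ^ n) has_real_derivative (\<Sum>n. diffs c n * t ^ n)) (at t)"
      by (rule termdiffs_strong_converges_everywhere)
    moreover have "diffs c n = (G ^^ n) (G X) \<bullet> b / fact n" for n
      by (simp add: diffs_def c_def funpow_swap1 del: of_nat_Suc)
    ultimately show ?thesis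
      by (simp add: series c_def has_real_derivative_iff_has_vector_derivative)
  qed
  then have "((\<lambda>t. linear_flow G t X) has_vector_derivative linear_flow G t (G X)) (at t)"
    unfolding has_vector_derivative_def by (subst has_derivative_componentwise_within) simp
  then show ?thesis
    by (simp add: linear_flow_commute[OF assms assms])
qed

section \<open>Lindblad generators\<close>

locale lindblad_generator =
  fixes H :: "'n::finite cmat" and L :: "nat \<Rightarrow> 'n cmat" and M :: nat
  assumes hermitian_H: "hermitian H"
begin

abbreviation G :: "'n cmat \<Rightarrow> 'n cmat" where
  "G \<equiv> lindblad H L M"

definition K :: "'n cmat" where
  "K = csmult (- \<i>) H - csmult (1 / 2) (\<Sum>k<M. adj (L k) ** L k)"

lemma adj_K: "adj K = csmult \<i> H - csmult (1 / 2) (\<Sum>k<M. adj (L k) ** L k)"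
  using hermitian_H by (simp add: K_def adj_diff adj_csmult adj_sum adj_mult hermitian_def)

lemma K_add_adj_K: "K + adj K = - (\<Sum>k<M. adj (L k) ** L k)"
  unfolding adj_K by (simp add: K_def vec_eq_iff)

lemma lindblad_eq: "G X = K ** X + X ** adj K + (\<Sum>k<M. L k ** X ** adj (L k))"
proof -
  define S where "S = (\<Sum>k<M. adj (L k) ** L k)"
  have "(\<Sum>k<M. dissipator (L k) X)
      = (\<Sum>k<M. L k ** X ** adj (L k)) - csmult (1 / 2) (S ** X + X ** S)"
    by (simp add: dissipator_def S_def sum_subtractf csmult_sum[symmetric] sum.distrib
        matrix_mult_linear_simps matrix_mul_assoc)
  then show ?thesis
    unfolding lindblad_def adj_K
    by (simp add: K_def matrix_mult_linear_simps csmult_mult_left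
        csmult_mult_right flip: S_def) (simp add: vec_eq_iff algebra_simps)
qed

lemma linear_G: "linear G"
  by (rule linearI)
    (simp_all add: lindblad_eq matrix_mult_linear_simps sum.distrib scaleR_right_distrib
      scaleR_sum_right)

lemma bounded_linear_G: "bounded_linear G"
  using linear_G by (simp add: linear_conv_bounded_linear)

lemma G_csmult: "G (csmult c X) = csmult c (G X)"
  by (simp add: lindblad_eq csmult_add csmult_sum csmult_mult_left csmult_mult_right)

lemma mtrace_G: "mtrace (G X) = 0"
proof -
  have "mtrace (L k ** X ** adj (L k)) = mtrace (adj (L k) ** L k ** X)" for k
    using mtrace_mult_commute[of "L k ** X" "adj (L k)"] by (simp add: matrix_mul_assoc)
  then have "mtrace (G X) = mtrace ((K + adj K + (\<Sum>k<M. adj (L k) ** L k)) ** X)"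
    by (simp add: lindblad_eq mtrace_add mtrace_sum matrix_mult_linear_simps
        mtrace_mult_commute[of X])
  then show ?thesis
    by (simp add: K_add_adj_K mtrace_zero)
qed

lemma is_solution_linear_flow: "is_solution G (\<lambda>t. linear_flow G t X)"
  by (simp add: is_solution_def
      has_vector_derivative_at_within[OF linear_flow_has_vector_derivative[OF bounded_linear_G]])

lemma has_vector_derivative_solution:
  assumes "is_solution G \<rho>" "0 \<le> t" "linear F"
  shows "((\<lambda>t. F (\<rho> t)) has_vector_derivative F (G (\<rho> t))) (at t within {0..})"
  using assms by (simp add: is_solution_def has_vector_derivative_linear)

text \<open>To first order in \<open>h\<close>, \<open>p + h G(p)\<close> agrees with the positive matrix
  \<open>(1 + h K) p (1 + h K)\<^sup>* + h \<Sum>\<^sub>k L\<^sub>k p L\<^sub>k\<^sup>*\<close>.\<close>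

lemma subtangential_psd:
  assumes "psd p" and normal: "\<And>Z. psd Z \<Longrightarrow> N \<bullet> (Z - p) \<le> 0"
  shows "N \<bullet> G p \<le> 0"
proof -
  have "N \<bullet> G p + h * (N \<bullet> (K ** p ** adj K)) \<le> 0" if "0 < h" for h
  proof -
    define \<Phi> where "\<Phi> = (mat 1 + h *\<^sub>R K) ** p ** adj (mat 1 + h *\<^sub>R K)
      + h *\<^sub>R (\<Sum>k<M. L k ** p ** adj (L k))"
    have "psd \<Phi>"
      unfolding \<Phi>_def using assms(1) that
      by (intro psd_add psd_scaleR psd_sum psd_sandwich) simp_all
    moreover have "\<Phi> - p = h *\<^sub>R (G p + h *\<^sub>R (K ** p ** adj K))"
      by (simp add: \<Phi>_def lindblad_eq adj_add adj_scaleR matrix_mult_linear_simps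
          scaleR_right_distrib algebra_simps)
    ultimately have "h * (N \<bullet> G p + h * (N \<bullet> (K ** p ** adj K))) \<le> 0"
      using normal[of \<Phi>] by (simp add: inner_add_right)
    then show ?thesis
      using that by (simp add: mult_le_0_iff)
  qed
  then have "\<forall>\<^sub>F h in at_right 0. N \<bullet> G p + h * (N \<bullet> (K ** p ** adj K)) \<le> 0"
    using eventually_at_right_less[of 0] by (rule eventually_mono[rotated])
  moreover have "((\<lambda>h. N \<bullet> G p + h * (N \<bullet> (K ** p ** adj K))) \<longlongrightarrow> N \<bullet> G p) (at_right 0)"
    by (auto intro!: tendsto_eq_intros)
  ultimately show ?thesis
    by (intro tendsto_upperbound) auto
qed

lemma psd_preserved:
  assumes "is_solution G \<rho>" "psd (\<rho> 0)" "0 \<le> t"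
  shows "psd (\<rho> t)"
proof -
  obtain B where "B-lipschitz_on UNIV G"
    using bounded_linear.lipschitz_boundE[OF bounded_linear_G] .
  then have "\<rho> t \<in> {A. psd A}"
    by (rule closed_convex_forward_invariant[OF convex_psd closed_psd])
      (use assms in \<open>auto simp: is_solution_def intro: subtangential_psd\<close>)
  then show ?thesis
    by simp
qed

lemma mtrace_preserved:
  assumes "is_solution G \<rho>" "0 \<le> t"
  shows "mtrace (\<rho> t) = mtrace (\<rho> 0)"
proof -
  have "((\<lambda>s. mtrace (\<rho> s)) has_derivative (\<lambda>h. 0)) (at s within {0..})" if "s \<in> {0..}" for s
    using has_vector_derivative_solution[OF assms(1) _ linear_mtrace, of s] that
    by (simp add: has_vector_derivative_def mtrace_G)
  then show ?thesis
    using has_derivative_zero_constant[of "{0..}" "\<lambda>s. mtrace (\<rho> s)"] assms(2)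
    by (metis atLeast_iff convex_real_interval(1) order_refl)
qed

lemma density_preserved: "is_solution G \<rho> \<Longrightarrow> density (\<rho> 0) \<Longrightarrow> 0 \<le> t \<Longrightarrow> density (\<rho> t)"
  using psd_preserved[of \<rho> t] mtrace_preserved[of \<rho> t] by (simp add: density_def)

end

section \<open>Weight outside the target subspace\<close>

locale orthogonal_projection =
  fixes P :: "'n::finite cmat"
  assumes orth_proj_P: "orth_proj P"
begin

definition Q :: "'n cmat" where
  "Q = mat 1 - P"

definition leakage :: "'n cmat \<Rightarrow> real" where
  "leakage X = Re (mtrace (Q ** X))"

lemma adj_P [simp]: "adj P = P" and P_P [simp]: "P ** P = P"
  using orth_proj_P by (auto simp: orth_proj_def hermitian_def)

lemma adj_Q [simp]: "adj Q = Q" and Q_Q [simp]: "Q ** Q = Q"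
  and P_Q [simp]: "P ** Q = 0" and Q_P [simp]: "Q ** P = 0"
  by (simp_all add: Q_def adj_diff matrix_mult_linear_simps)

lemma mult_P_P [simp]: "X ** P ** P = X ** P" and mult_Q_Q [simp]: "X ** Q ** Q = X ** Q"
  and mult_P_Q [simp]: "X ** P ** Q = 0" and mult_Q_P [simp]: "X ** Q ** P = 0"
  by (simp_all flip: matrix_mul_assoc)

lemma psd_P: "psd P"
  using psd_sandwich[OF psd_mat_1, of P] by simp

lemma linear_leakage: "linear leakage"
  by (rule linearI)
    (simp_all add: leakage_def matrix_mult_linear_simps mtrace_add mtrace_scaleR)

lemma mtrace_P_sandwich: "mtrace (P ** X ** P) = mtrace (P ** X)"
  using mtrace_mult_commute[of "P ** X" P] by (simp add: matrix_mul_assoc)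

lemma leakage_eq: "leakage X = Re (mtrace X) - Re (mtrace (P ** X))"
  by (simp add: leakage_def Q_def matrix_mult.diff_left mtrace_diff)

lemma leakage_sandwich: "leakage X = Re (mtrace (Q ** X ** Q))"
  using mtrace_mult_commute[of "Q ** X" Q] by (simp add: leakage_def matrix_mul_assoc)

lemma leakage_nonneg: "psd X \<Longrightarrow> 0 \<le> leakage X"
  using psd_mtrace_nonneg[OF psd_sandwich, of X Q] by (simp add: leakage_sandwich)

lemma norm_off_diagonal_le_leakage:
  assumes "density X" and "Re (mtrace (A ** X ** adj A)) \<le> 1"
  shows "norm (A ** X ** Q) \<le> sqrt (leakage X)" and "norm (Q ** X ** adj A) \<le> sqrt (leakage X)"
proof -
  have "Re (mtrace (A ** X ** adj A)) * leakage X \<le> 1 * leakage X"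
    using assms leakage_nonneg by (intro mult_right_mono) (simp_all add: density_def)
  then show "norm (A ** X ** Q) \<le> sqrt (leakage X)" "norm (Q ** X ** adj A) \<le> sqrt (leakage X)"
    using psd_norm_sandwich_le[of X A Q] psd_norm_sandwich_le[of X Q A] assms(1)
    by (auto intro!: real_le_rsqrt simp: density_def leakage_sandwich mult.commute)
qed

lemma norm_Q_mult_le_leakage: "density X \<Longrightarrow> norm (Q ** X) \<le> sqrt (leakage X)"
  using norm_off_diagonal_le_leakage(2)[of X "mat 1"] by (simp add: density_def)

lemma dist0_le_leakage:
  assumes "density X"
  shows "dist0 P X \<le> 2 * sqrt (leakage X)"
proof -
  have "Re (mtrace (P ** X ** adj P)) \<le> 1"
    using assms leakage_nonneg[of X] by (simp add: density_def leakage_eq mtrace_P_sandwich)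
  then have "norm (P ** X ** Q) \<le> sqrt (leakage X)"
    by (rule norm_off_diagonal_le_leakage(1)[OF assms])
  moreover have "X - P ** X ** P = Q ** X + P ** X ** Q"
    by (simp add: Q_def matrix_mult_linear_simps)
  ultimately show ?thesis
    using norm_triangle_ineq[of "Q ** X" "P ** X ** Q"] norm_Q_mult_le_leakage[OF assms]
    by (simp add: dist0_def)
qed

lemma leakage_le_dist0:
  obtains C where "0 < C" "\<And>X. leakage X \<le> C * dist0 P X"
proof -
  obtain C where C: "0 < C" "\<And>X. norm (leakage X) \<le> C * norm X"
    using linear_bounded_pos[OF linear_leakage] by blast
  have "leakage X = leakage (X - P ** X ** P)" for X
    by (simp add: leakage_def matrix_mult.diff_right matrix_mul_assoc)
  then have "leakage X \<le> C * dist0 P X" for X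
    using C(2)[of "X - P ** X ** P"] by (simp add: dist0_def)
  then show ?thesis
    using C(1) that by blast
qed

end

section \<open>Invariant subspaces\<close>

locale invariant_lindblad = lindblad_generator H L M + orthogonal_projection P
  for H :: "'n::finite cmat" and L M and P :: "'n cmat" +
  assumes P_nonzero: "P \<noteq> 0" and invariant_P: "invariant P G"
begin

lemma Q_solution_eq_0:
  assumes sol: "is_solution G \<rho>" and dens: "density (\<rho> 0)" and "mtrace (P ** \<rho> 0) = 1" "0 \<le> t"
  shows "Q ** \<rho> t = 0"
proof -
  have "mtrace (P ** \<rho> t) = 1"
    using invariant_P assms by (simp add: invariant_def)
  then have "leakage (\<rho> t) = 0"
    using density_preserved[OF sol dens \<open>0 \<le> t\<close>] by (simp add: leakage_eq density_def)
  then show ?thesis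
    using norm_Q_mult_le_leakage[OF density_preserved[OF sol dens \<open>0 \<le> t\<close>]] by simp
qed

lemma Q_G_P: "Q ** G P = 0"
proof -
  define \<tau> where "\<tau> = Re (mtrace P)"
  define \<rho> where "\<rho> = (\<lambda>t. linear_flow G t (P /\<^sub>R \<tau>))"
  have \<tau>: "0 < \<tau>" and dens: "density (P /\<^sub>R \<tau>)"
    unfolding \<tau>_def by (rule density_normalize[OF psd_P P_nonzero])+
  have \<rho>_0: "\<rho> 0 = P /\<^sub>R \<tau>" and sol: "is_solution G \<rho>"
    by (simp_all add: \<rho>_def linear_flow_0 is_solution_linear_flow)
  have "mtrace (P ** \<rho> 0) = 1"
    using dens by (simp add: \<rho>_0 matrix_mult.scaleR_right density_def)
  then have Q_\<rho>: "Q ** \<rho> t = 0" if "t \<in> {0..}" for t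
    using Q_solution_eq_0[OF sol] dens \<rho>_0 that by simp
  have "((\<lambda>t. Q ** \<rho> t) has_vector_derivative Q ** G (\<rho> 0)) (at 0 within {0..})"
    using sol by (intro has_vector_derivative_solution bounded_linear.linear
        matrix_mult.bounded_linear_right) simp_all
  moreover have "((\<lambda>t. Q ** \<rho> t) has_vector_derivative 0) (at 0 within {0..})"
    by (rule has_vector_derivative_transform[OF _ _ has_vector_derivative_const])
      (simp_all add: Q_\<rho>)
  moreover have "at (0 :: real) within {0..} \<noteq> bot"
    by (simp add: at_within_Ici_at_right)
  ultimately have "Q ** G (\<rho> 0) = 0"
    using vector_derivative_unique_within by blast
  then show ?thesis
    using \<tau> by (simp add: \<rho>_0 linear_scale[OF linear_G] matrix_mult.scaleR_right)
qed

lemma Q_L_P: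
  assumes "k < M"
  shows "Q ** L k ** P = 0"
proof -
  have "(\<Sum>k<M. (Q ** L k ** P) ** adj (Q ** L k ** P)) = Q ** G P ** Q"
    by (simp add: lindblad_eq matrix_mult_linear_simps adj_mult matrix_mul_assoc)
  then have "mtrace (\<Sum>k<M. (Q ** L k ** P) ** adj (Q ** L k ** P)) = 0"
    by (simp add: Q_G_P mtrace_zero)
  then have "(\<Sum>k<M. (norm (Q ** L k ** P))\<^sup>2) = 0"
    unfolding mtrace_sum mtrace_mult_adj of_real_sum[symmetric] by (simp only: of_real_eq_0_iff)
  then show ?thesis
    using assms by (simp add: sum_nonneg_eq_0_iff)
qed

lemma Q_K_P: "Q ** K ** P = 0"
proof -
  have "Q ** G P = Q ** K ** P"
    using Q_L_P by (simp add: lindblad_eq matrix_mult_linear_simps matrix_mul_assoc)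
  then show ?thesis
    by (simp add: Q_G_P)
qed

lemma Q_mult_Q:
  assumes "Q ** A ** P = 0"
  shows "Q ** A ** Q = Q ** A" and "X ** Q ** adj A ** Q = X ** adj A ** Q"
proof -
  show left: "Q ** A ** Q = Q ** A"
    using assms by (simp add: Q_def matrix_mult.diff_right)
  have "Q ** adj A ** Q = adj A ** Q"
    using arg_cong[OF left, of adj] by (simp add: adj_mult matrix_mul_assoc)
  then show "X ** Q ** adj A ** Q = X ** adj A ** Q"
    by (metis matrix_mul_assoc)
qed

lemma Q_G_Q: "Q ** G (Q ** X ** Q) ** Q = Q ** G X ** Q"
proof -
  have expand: "Q ** G Y ** Q = Q ** K ** Y ** Q + Q ** Y ** adj K ** Q
      + (\<Sum>k<M. Q ** L k ** Y ** adj (L k) ** Q)" for Y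
    by (simp add: lindblad_eq matrix_mult_linear_simps matrix_mul_assoc)
  show ?thesis
    unfolding expand by (simp add: matrix_mul_assoc Q_mult_Q[OF Q_K_P] Q_mult_Q[OF Q_L_P])
qed

lemma leakage_G_nonpos:
  assumes "psd X"
  shows "leakage (G X) \<le> 0"
proof -
  define Y where "Y = Q ** X ** Q"
  have "psd Y"
    using psd_sandwich[OF assms, of Q] by (simp add: Y_def)
  have "P ** G Y ** P = (\<Sum>k<M. (P ** L k) ** Y ** adj (P ** L k))"
    by (simp add: Y_def lindblad_eq matrix_mult_linear_simps adj_mult matrix_mul_assoc)
  then have "0 \<le> Re (mtrace (P ** G Y ** P))"
    using \<open>psd Y\<close> by (simp only:) (intro psd_mtrace_nonneg psd_sum psd_sandwich)
  moreover have "leakage (G X) = leakage (G Y)"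
    by (simp add: leakage_sandwich Y_def Q_G_Q)
  ultimately show ?thesis
    by (simp add: leakage_eq mtrace_G mtrace_P_sandwich)
qed

lemma has_real_derivative_leakage:
  assumes "is_solution G \<rho>" "0 \<le> t"
  shows "((\<lambda>t. leakage (\<rho> t)) has_real_derivative leakage (G (\<rho> t))) (at t within {0..})"
  using has_vector_derivative_solution[OF assms linear_leakage]
  by (simp add: has_real_derivative_iff_has_vector_derivative)

lemma leakage_antimono:
  assumes sol: "is_solution G \<rho>" and dens: "density (\<rho> 0)" and "0 \<le> s" "s \<le> t"
  shows "leakage (\<rho> t) \<le> leakage (\<rho> s)"
proof (rule deriv_nonpos_imp_le[where f = "\<lambda>t. leakage (\<rho> t)", OF \<open>s \<le> t\<close>])
  show "((\<lambda>t. leakage (\<rho> t)) has_real_derivative leakage (G (\<rho> x))) (at x within {s..t})"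
    if "s \<le> x" for x
    by (rule DERIV_subset[OF has_real_derivative_leakage[OF sol]]) (use that \<open>0 \<le> s\<close> in auto)
  show "leakage (G (\<rho> x)) \<le> 0" if "s < x" for x
    using density_preserved[OF sol dens, of x] that \<open>0 \<le> s\<close>
    by (intro leakage_G_nonpos) (simp add: density_def)
qed

lemma stable_P: "stable P G"
  unfolding stable_def
proof (intro allI impI)
  fix \<epsilon> :: real assume "0 < \<epsilon>"
  obtain C where C: "0 < C" "\<And>X. leakage X \<le> C * dist0 P X"
    using leakage_le_dist0 by blast
  have "dist0 P (\<rho> t) < \<epsilon>"
    if sol: "is_solution G \<rho>" and dens: "density (\<rho> 0)"
      and close: "dist0 P (\<rho> 0) < (\<epsilon> / 2)\<^sup>2 / C" and t: "0 \<le> t" for \<rho> t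
  proof -
    have "leakage (\<rho> t) \<le> leakage (\<rho> 0)"
      by (rule leakage_antimono[OF sol dens _ t]) simp
    also have "\<dots> \<le> C * dist0 P (\<rho> 0)"
      by (rule C)
    also have "\<dots> < (\<epsilon> / 2)\<^sup>2"
      using close C(1) by (simp add: field_simps)
    finally have "sqrt (leakage (\<rho> t)) < \<epsilon> / 2"
      using \<open>0 < \<epsilon>\<close> by (intro real_less_lsqrt) auto
    then show ?thesis
      using dist0_le_leakage[OF density_preserved[OF sol dens t]] by simp
  qed
  then show "\<exists>\<delta>>0. \<forall>\<rho>. is_solution G \<rho> \<longrightarrow> density (\<rho> 0) \<longrightarrow> dist0 P (\<rho> 0) < \<delta> \<longrightarrow>
      (\<forall>t\<ge>0. dist0 P (\<rho> t) < \<epsilon>)"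
    using \<open>0 < \<epsilon>\<close> C(1) by (intro exI[of _ "(\<epsilon> / 2)\<^sup>2 / C"]) auto
qed

end

section \<open>Asymptotic stability and the compressed generator\<close>

text \<open>The terms \<open>Q X Q - X\<close> make this map injective exactly when \<open>X \<mapsto> Q G(X) Q\<close> is injective on the
  \<open>Q\<close>-block.\<close>

definition block_compression :: "'n::finite cmat \<Rightarrow> ('n cmat \<Rightarrow> 'n cmat) \<Rightarrow> 'n cmat \<Rightarrow> 'n cmat" where
  "block_compression P G X =
    (mat 1 - P) ** G X ** (mat 1 - P) + (mat 1 - P) ** X ** (mat 1 - P) - X"

context invariant_lindblad
begin

abbreviation compression :: "'n cmat \<Rightarrow> 'n cmat" where
  "compression \<equiv> block_compression P G"

lemma compression_eq: "compression X = Q ** G X ** Q + Q ** X ** Q - X"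
  by (simp add: block_compression_def Q_def)

lemma linear_compression: "linear compression"
  unfolding compression_eq[abs_def]
  by (rule linearI)
    (simp_all add: linear_add[OF linear_G] linear_scale[OF linear_G] matrix_mult_linear_simps
      algebra_simps)

lemma compression_csmult: "compression (csmult c X) = csmult c (compression X)"
  by (simp add: compression_eq G_csmult csmult_add csmult_diff csmult_mult_left csmult_mult_right)

lemma compression_sandwich: "compression (Q ** X ** Q) = Q ** G X ** Q"
  by (simp add: compression_eq Q_G_Q matrix_mul_assoc)

lemma compression_eq_0_iff: "compression X = 0 \<longleftrightarrow> Q ** X ** Q = X \<and> Q ** G X ** Q = 0"
proof
  assume kernel: "compression X = 0"
  have "Q ** compression X ** Q = Q ** G X ** Q"
    by (simp add: compression_eq matrix_mult_linear_simps matrix_mul_assoc)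
  then have "Q ** G X ** Q = 0"
    by (simp add: kernel)
  then show "Q ** X ** Q = X \<and> Q ** G X ** Q = 0"
    using kernel by (simp add: compression_eq)
qed (simp add: compression_eq)

lemma leakage_potential_exists:
  assumes "inj compression"
  obtains \<phi> where "linear \<phi>" "\<And>X. \<phi> (G X) = leakage X"
proof
  have "linear (inv compression)"
    using inj_linear_imp_inv_bounded_linear[of compression] linear_compression assms
    by (simp add: linear_conv_bounded_linear)
  then show "linear (\<lambda>X. leakage (inv compression (Q ** X ** Q)))"
    by (intro linearI)
      (simp_all add: matrix_mult_linear_simps linear_add linear_scale linear_add[OF linear_leakage]
        linear_scale[OF linear_leakage])
  show "leakage (inv compression (Q ** G X ** Q)) = leakage X" for X
    by (simp add: assms leakage_sandwich matrix_mul_assoc flip: compression_sandwich)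
qed

text \<open>Along a solution, \<open>\<phi>\<close> is bounded and has the nonincreasing function \<open>q(t) = leakage (\<rho> t)\<close> as
  derivative, so \<open>t q(t) \<le> \<phi>(\<rho>(t)) - \<phi>(\<rho>(0))\<close>.\<close>

lemma leakage_decay:
  assumes "inj compression"
  obtains C where "\<And>\<rho> t. is_solution G \<rho> \<Longrightarrow> density (\<rho> 0) \<Longrightarrow> 0 \<le> t \<Longrightarrow> t * leakage (\<rho> t) \<le> C"
proof -
  obtain \<phi> where linear_\<phi>: "linear \<phi>" and \<phi>_G: "\<And>X. \<phi> (G X) = leakage X"
    using leakage_potential_exists[OF assms] by blast
  obtain B where B: "0 < B" "\<And>X. norm (\<phi> X) \<le> B * norm X"
    using linear_bounded_pos[OF linear_\<phi>] by blast
  have "t * leakage (\<rho> t) \<le> 2 * B"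
    if sol: "is_solution G \<rho>" and dens: "density (\<rho> 0)" and t: "0 \<le> t" for \<rho> t
  proof -
    have bound: "\<bar>\<phi> (\<rho> s)\<bar> \<le> B" if "0 \<le> s" for s
    proof -
      have "B * norm (\<rho> s) \<le> B * 1"
        using density_norm_le_1[OF density_preserved[OF sol dens that]] B(1)
        by (intro mult_left_mono) simp_all
      then show ?thesis
        using B(2)[of "\<rho> s"] by simp
    qed
    have "t * leakage (\<rho> t) - \<phi> (\<rho> t) \<le> 0 * leakage (\<rho> t) - \<phi> (\<rho> 0)"
    proof (rule deriv_nonpos_imp_le[where f = "\<lambda>s. s * leakage (\<rho> t) - \<phi> (\<rho> s)", OF t])
      fix s :: real assume "0 \<le> s"
      have "((\<lambda>s. \<phi> (\<rho> s)) has_real_derivative leakage (\<rho> s)) (at s within {0..t})"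
        by (rule DERIV_subset[where s = "{0..}"])
          (use has_vector_derivative_solution[OF sol \<open>0 \<le> s\<close> linear_\<phi>] in
            \<open>auto simp: \<phi>_G has_real_derivative_iff_has_vector_derivative\<close>)
      then show "((\<lambda>s. s * leakage (\<rho> t) - \<phi> (\<rho> s)) has_real_derivative
          leakage (\<rho> t) - leakage (\<rho> s)) (at s within {0..t})"
        by (auto intro!: derivative_eq_intros)
    next
      show "leakage (\<rho> t) - leakage (\<rho> s) \<le> 0" if "0 < s" "s < t" for s
        using leakage_antimono[OF sol dens, of s t] that by simp
    qed
    then show ?thesis
      using bound[of t] bound[of 0] t by simp
  qed
  then show ?thesis
    using that by blast
qed

lemma leakage_tendsto_0:
  assumes "inj compression" and sol: "is_solution G \<rho>" and dens: "density (\<rho> 0)"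
  shows "((\<lambda>t. leakage (\<rho> t)) \<longlongrightarrow> 0) at_top"
proof -
  obtain C where C: "\<And>t. 0 \<le> t \<Longrightarrow> t * leakage (\<rho> t) \<le> C"
    using leakage_decay[OF assms(1)] sol dens by metis
  show ?thesis
  proof (rule tendsto_sandwich)
    show "\<forall>\<^sub>F t in at_top. 0 \<le> leakage (\<rho> t)"
      using eventually_ge_at_top[of 0]
      by eventually_elim
        (use density_preserved[OF sol dens] in \<open>auto intro: leakage_nonneg simp: density_def\<close>)
    show "\<forall>\<^sub>F t in at_top. leakage (\<rho> t) \<le> C / t"
      using eventually_gt_at_top[of 0]
      by eventually_elim (use C in \<open>simp add: field_simps\<close>)
    show "((\<lambda>t. C / t) \<longlongrightarrow> 0) at_top"
      by (intro tendsto_divide_0[OF tendsto_const] filterlim_at_top_imp_at_infinity filterlim_ident)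
  qed simp
qed

lemma GAS_if_inj_compression:
  assumes "inj compression"
  shows "GAS P G"
  unfolding GAS_def
proof (intro conjI allI impI invariant_P stable_P)
  fix \<rho> assume sol: "is_solution G \<rho>" and dens: "density (\<rho> 0)"
  show "((\<lambda>t. dist0 P (\<rho> t)) \<longlongrightarrow> 0) at_top"
  proof (rule tendsto_sandwich[OF _ _ tendsto_const])
    show "\<forall>\<^sub>F t in at_top. 0 \<le> dist0 P (\<rho> t)"
      by (simp add: dist0_def)
    show "\<forall>\<^sub>F t in at_top. dist0 P (\<rho> t) \<le> 2 * sqrt (leakage (\<rho> t))"
      using eventually_ge_at_top[of 0]
      by eventually_elim (use dist0_le_leakage density_preserved[OF sol dens] in blast)
    show "((\<lambda>t. 2 * sqrt (leakage (\<rho> t))) \<longlongrightarrow> 0) at_top"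
      by (auto intro!: tendsto_eq_intros leakage_tendsto_0[OF assms sol dens])
  qed
qed

lemma GAS_imp_Q_flow_tendsto_0:
  assumes "GAS P G"
  shows "((\<lambda>t. Q ** linear_flow G t X ** Q) \<longlongrightarrow> 0) at_top"
proof -
  define vanishes where "vanishes = (\<lambda>X. ((\<lambda>t. Q ** linear_flow G t X ** Q) \<longlongrightarrow> 0) at_top)"
  have "vanishes X"
  proof (rule density_span_induct)
    fix X :: "'n cmat" assume "density X"
    then have "((\<lambda>t. dist0 P (linear_flow G t X)) \<longlongrightarrow> 0) at_top"
      using assms is_solution_linear_flow[of X] linear_flow_0[of G X] by (simp add: GAS_def)
    then have "((\<lambda>t. linear_flow G t X - P ** linear_flow G t X ** P) \<longlongrightarrow> 0) at_top"
      unfolding dist0_def by (simp only: tendsto_norm_zero_iff)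
    then have "((\<lambda>t. Q ** (linear_flow G t X - P ** linear_flow G t X ** P) ** Q) \<longlongrightarrow> 0) at_top"
      by (intro matrix_mult.tendsto_left_zero matrix_mult.tendsto_right_zero)
    then show "vanishes X"
      by (simp add: vanishes_def matrix_mult_linear_simps matrix_mul_assoc)
  next
    show "vanishes (X + Y)" if "vanishes X" "vanishes Y" for X Y
      using tendsto_add[OF that[unfolded vanishes_def]]
      by (simp add: vanishes_def linear_flow_add[OF bounded_linear_G] matrix_mult_linear_simps)
  next
    fix c X assume "vanishes X"
    have csmult: "bounded_linear (csmult c :: 'n cmat \<Rightarrow> 'n cmat)"
      using linear_csmult by (simp add: linear_conv_bounded_linear)
    from bounded_linear.tendsto_zero[OF csmult \<open>vanishes X\<close>[unfolded vanishes_def]]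
    show "vanishes (csmult c X)"
      by (simp add: vanishes_def csmult_mult_left csmult_mult_right G_csmult
          flip: linear_flow_commute[OF csmult bounded_linear_G])
  qed
  then show ?thesis
    by (simp add: vanishes_def)
qed

lemma Q_flow_eq_if_compression_eq_0:
  assumes "compression X = 0"
  shows "Q ** linear_flow G t X ** Q = X"
proof -
  have X: "Q ** X ** Q = X" "Q ** G X ** Q = 0"
    using assms by (simp_all add: compression_eq_0_iff)
  have "Q ** (G ^^ Suc n) X ** Q = 0" for n
  proof (induction n)
    case (Suc n)
    have "Q ** (G ^^ Suc (Suc n)) X ** Q = Q ** G (Q ** (G ^^ Suc n) X ** Q) ** Q"
      by (simp add: Q_G_Q)
    then show ?case
      by (simp only: Suc linear_0[OF linear_G] matrix_mult.zero_left matrix_mult.zero_right)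
  qed (simp add: X)
  then have terms: "Q ** (G ^^ n) X ** Q = (if n = 0 then X else 0)" for n
    using X(1) by (cases n) simp_all
  have "bounded_linear (\<lambda>Y. Q ** Y ** Q)"
    by (rule bounded_linear_compose[OF matrix_mult.bounded_linear_left])
      (rule matrix_mult.bounded_linear_right)
  then have "Q ** linear_flow G t X ** Q = (\<Sum>n. (t ^ n / fact n) *\<^sub>R (Q ** (G ^^ n) X ** Q))"
    by (rule linear_flow_map[OF _ bounded_linear_G])
  also have "\<dots> = (\<Sum>n. (t ^ n / fact n) *\<^sub>R (if n = 0 then X else 0))"
    by (simp only: terms)
  also have "\<dots> = X"
    by (subst suminf_finite[of "{0}"]) auto
  finally show ?thesis .
qed

lemma GAS_iff_inj_compression: "GAS P G \<longleftrightarrow> inj compression"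
proof
  assume GAS: "GAS P G"
  show "inj compression"
  proof (subst linear_injective_0[OF linear_compression], intro allI impI)
    fix X assume "compression X = 0"
    then have "((\<lambda>t :: real. X) \<longlongrightarrow> 0) at_top"
      using GAS_imp_Q_flow_tendsto_0[OF GAS, of X] by (simp only: Q_flow_eq_if_compression_eq_0)
    then show "X = 0"
      by (simp add: tendsto_const_iff)
  qed
qed (rule GAS_if_inj_compression)

end

section \<open>Zero sets of polynomial functions\<close>

lemma negligible_if_negligible_affine_vimage:
  fixes S :: "'a::euclidean_space set"
  assumes "s \<noteq> 0" "negligible {w. a + s *\<^sub>R w \<in> S}"
  shows "negligible S"
proof (rule negligible_subset)
  show "negligible ((+) a ` (\<lambda>w. s *\<^sub>R w) ` {w. a + s *\<^sub>R w \<in> S})"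
    using assms(2)
    by (intro negligible_translation negligible_differentiable_image_negligible)
      (auto intro!: linear_imp_differentiable_on linear_scaleR)
  show "S \<subseteq> (+) a ` (\<lambda>w. s *\<^sub>R w) ` {w. a + s *\<^sub>R w \<in> S}"
  proof
    fix x assume "x \<in> S"
    moreover have "x = a + s *\<^sub>R ((x - a) /\<^sub>R s)"
      using \<open>s \<noteq> 0\<close> by simp
    ultimately show "x \<in> (+) a ` (\<lambda>w. s *\<^sub>R w) ` {w. a + s *\<^sub>R w \<in> S}"
      by (metis (mono_tags, lifting) imageI mem_Collect_eq)
  qed
qed

text \<open>By Fubini, almost every dilation with centre \<open>a\<close> pulls \<open>S\<close> back to a null set.\<close>

lemma negligible_if_null_on_lines:
  fixes S :: "'a::euclidean_space set"
  assumes S: "S \<in> sets borel"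
    and lines: "\<And>w. {s. a + s *\<^sub>R w \<in> S} \<in> null_sets (lborel :: real measure)"
  shows "negligible S"
proof -
  have "(\<lambda>p :: 'a \<times> real. a + snd p *\<^sub>R fst p) \<in> borel_measurable borel"
    by (intro borel_measurable_continuous_onI continuous_intros)
  then have "{p \<in> space (lborel \<Otimes>\<^sub>M lborel). a + snd p *\<^sub>R fst p \<notin> S}
      \<in> sets (lborel \<Otimes>\<^sub>M (lborel :: real measure))"
    unfolding lborel_prod using S by measurable
  moreover have "AE w in lborel. AE s in lborel. a + s *\<^sub>R w \<notin> S"
    using AE_not_in[OF lines] by simp
  ultimately have "AE s in lborel. AE w in lborel. a + s *\<^sub>R w \<notin> S"
    by (subst (asm) lborel_pair.AE_commute) auto
  moreover have "AE s in lborel. s \<noteq> (0 :: real)"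
    by (rule AE_lborel_singleton)
  ultimately have "AE s in lborel. s \<noteq> 0 \<and> (AE w in lborel. a + s *\<^sub>R w \<notin> S)"
    by eventually_elim auto
  moreover have "ae_filter (lborel :: real measure) \<noteq> bot"
    by (simp add: ae_filter_eq_bot_iff)
  ultimately obtain s :: real where "s \<noteq> 0" and ae: "AE w in lborel. a + s *\<^sub>R w \<notin> S"
    using eventually_happens' by blast
  have "negligible {w. a + s *\<^sub>R w \<in> S}"
    using AE_completion[OF ae]
    by (auto simp: eventually_ae_filter_negligible intro: negligible_subset)
  with \<open>s \<noteq> 0\<close> show ?thesis
    by (rule negligible_if_negligible_affine_vimage)
qed

lemma polyfun_continuous_on: "polyfun f \<Longrightarrow> continuous_on S f"
  by (induction rule: polyfun.induct) (auto intro!: continuous_intros)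

lemma polyfun_on_line:
  assumes "polyfun f"
  obtains p where "\<And>s. f (a + s *\<^sub>R w) = poly p s"
proof -
  have "\<exists>p. \<forall>s. f (a + s *\<^sub>R w) = poly p s"
    using assms
  proof (induction rule: polyfun.induct)
    case (const c)
    show ?case
      by (intro exI[of _ "[:c:]"]) simp
  next
    case (coord i)
    show ?case
      by (intro exI[of _ "[:a $ i, w $ i:]"]) simp
  next
    case (add f g)
    then show ?case
      by (metis poly_add)
  next
    case (mult f g)
    then show ?case
      by (metis poly_mult)
  qed
  then show ?thesis
    using that by blast
qed

lemma negligible_polyfun_zeros:
  fixes f :: "real ^ 'N \<Rightarrow> real"
  assumes f: "polyfun f" and a: "f a \<noteq> 0"
  shows "negligible {x. f x = 0}"
proof (rule negligible_if_null_on_lines)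
  show "{x. f x = 0} \<in> sets borel"
    by (intro borel_closed closed_Collect_eq polyfun_continuous_on f continuous_on_const)
  fix w
  obtain p where p: "\<And>s. f (a + s *\<^sub>R w) = poly p s"
    using polyfun_on_line[OF f] by blast
  have "p \<noteq> 0"
    using p[of 0] a by auto
  then show "{s. a + s *\<^sub>R w \<in> {x. f x = 0}} \<in> null_sets lborel"
    by (simp add: p poly_roots_finite finite_imp_null_set_lborel)
qed

lemma polyfun_uminus: "polyfun f \<Longrightarrow> polyfun (\<lambda>x. - f x)"
  using polyfun.mult[OF polyfun.const[of "-1"]] by fastforce

lemma polyfun_diff: "polyfun f \<Longrightarrow> polyfun g \<Longrightarrow> polyfun (\<lambda>x. f x - g x)"
  using polyfun.add[OF _ polyfun_uminus] by fastforce

definition cpolyfun :: "(real ^ 'N \<Rightarrow> complex) \<Rightarrow> bool" where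
  "cpolyfun f \<longleftrightarrow> polyfun (\<lambda>x. Re (f x)) \<and> polyfun (\<lambda>x. Im (f x))"

lemma cpolyfun_const: "cpolyfun (\<lambda>x. c)"
  by (simp add: cpolyfun_def polyfun.const)

lemma cpolyfun_add: "cpolyfun f \<Longrightarrow> cpolyfun g \<Longrightarrow> cpolyfun (\<lambda>x. f x + g x)"
  by (simp add: cpolyfun_def polyfun.add)

lemma cpolyfun_diff: "cpolyfun f \<Longrightarrow> cpolyfun g \<Longrightarrow> cpolyfun (\<lambda>x. f x - g x)"
  by (simp add: cpolyfun_def polyfun_diff)

lemma cpolyfun_mult: "cpolyfun f \<Longrightarrow> cpolyfun g \<Longrightarrow> cpolyfun (\<lambda>x. f x * g x)"
  by (simp add: cpolyfun_def polyfun.add polyfun.mult polyfun_diff)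

lemma cpolyfun_cnj: "cpolyfun f \<Longrightarrow> cpolyfun (\<lambda>x. cnj (f x))"
  by (simp add: cpolyfun_def polyfun_uminus)

lemma cpolyfun_sum: "(\<And>k. k \<in> I \<Longrightarrow> cpolyfun (f k)) \<Longrightarrow> cpolyfun (\<lambda>x. \<Sum>k\<in>I. f k x)"
  by (induction I rule: infinite_finite_induct) (simp_all add: cpolyfun_const cpolyfun_add)

lemma cpolyfun_prod: "(\<And>k. k \<in> I \<Longrightarrow> cpolyfun (f k)) \<Longrightarrow> cpolyfun (\<lambda>x. \<Prod>k\<in>I. f k x)"
  by (induction I rule: infinite_finite_induct) (simp_all add: cpolyfun_const cpolyfun_mult)

lemma cpolyfun_det:
  assumes "\<And>i j. cpolyfun (\<lambda>x. A x $ i $ j)"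
  shows "cpolyfun (\<lambda>x. det (A x :: complex ^ 'm ^ 'm::finite))"
  unfolding det_def by (intro cpolyfun_sum cpolyfun_mult cpolyfun_prod cpolyfun_const assms)

lemma negligible_cpolyfun_zeros:
  assumes "cpolyfun f" "f a \<noteq> 0"
  shows "negligible {x. f x = 0}"
proof -
  have "Re (f a) \<noteq> 0 \<or> Im (f a) \<noteq> 0"
    using assms(2) by (simp add: complex_eq_iff)
  then have "negligible {x. Re (f x) = 0} \<or> negligible {x. Im (f x) = 0}"
    using assms(1) negligible_polyfun_zeros[where a = a] by (auto simp: cpolyfun_def)
  then show ?thesis
    by (auto intro: negligible_subset)
qed

lemma poly_matrix_fun_iff: "poly_matrix_fun F \<longleftrightarrow> (\<forall>i j. cpolyfun (\<lambda>x. F x $ i $ j))"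
  by (simp add: poly_matrix_fun_def cpolyfun_def)

lemma poly_matrix_fun_const: "poly_matrix_fun (\<lambda>x. A)"
  by (simp add: poly_matrix_fun_iff cpolyfun_const)

lemma poly_matrix_fun_add:
  "poly_matrix_fun F \<Longrightarrow> poly_matrix_fun F' \<Longrightarrow> poly_matrix_fun (\<lambda>x. F x + F' x)"
  by (simp add: poly_matrix_fun_iff cpolyfun_add)

lemma poly_matrix_fun_diff:
  "poly_matrix_fun F \<Longrightarrow> poly_matrix_fun F' \<Longrightarrow> poly_matrix_fun (\<lambda>x. F x - F' x)"
  by (simp add: poly_matrix_fun_iff cpolyfun_diff)

lemma poly_matrix_fun_mult:
  "poly_matrix_fun F \<Longrightarrow> poly_matrix_fun F' \<Longrightarrow> poly_matrix_fun (\<lambda>x. F x ** F' x)"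
  by (simp add: poly_matrix_fun_iff matrix_matrix_mult_def cpolyfun_mult cpolyfun_sum)

lemma poly_matrix_fun_adj: "poly_matrix_fun F \<Longrightarrow> poly_matrix_fun (\<lambda>x. adj (F x))"
  by (simp add: poly_matrix_fun_iff cpolyfun_cnj)

lemma poly_matrix_fun_csmult: "poly_matrix_fun F \<Longrightarrow> poly_matrix_fun (\<lambda>x. csmult c (F x))"
  by (simp add: poly_matrix_fun_iff cpolyfun_mult cpolyfun_const)

lemma poly_matrix_fun_sum:
  "(\<And>k. k \<in> I \<Longrightarrow> poly_matrix_fun (F k)) \<Longrightarrow> poly_matrix_fun (\<lambda>x. \<Sum>k\<in>I. F k x)"
  by (simp add: poly_matrix_fun_iff cpolyfun_sum)

lemma poly_matrix_fun_lindblad: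
  assumes "poly_matrix_fun H" "\<And>k. k < M \<Longrightarrow> poly_matrix_fun (L k)"
  shows "poly_matrix_fun (\<lambda>x. lindblad (H x) (\<lambda>k. L k x) M X)"
  unfolding lindblad_def dissipator_def
  by (intro poly_matrix_fun_add poly_matrix_fun_diff poly_matrix_fun_csmult poly_matrix_fun_sum
      poly_matrix_fun_mult poly_matrix_fun_adj poly_matrix_fun_const assms) simp_all

lemma poly_matrix_fun_block_compression:
  assumes "poly_matrix_fun (\<lambda>x. G x X)"
  shows "poly_matrix_fun (\<lambda>x. block_compression P (G x) X)"
  unfolding block_compression_def
  by (intro poly_matrix_fun_add poly_matrix_fun_diff poly_matrix_fun_mult
      poly_matrix_fun_const assms)

section \<open>Determinants of complex-linear maps on matrices\<close>

definition flatten :: "'n::finite cmat \<Rightarrow> complex ^ ('n \<times> 'n)" where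
  "flatten X = (\<chi> p. X $ fst p $ snd p)"

definition unflatten :: "complex ^ ('n \<times> 'n) \<Rightarrow> 'n::finite cmat" where
  "unflatten v = (\<chi> i j. v $ (i, j))"

definition superoperator_matrix ::
  "('n::finite cmat \<Rightarrow> 'n cmat) \<Rightarrow> complex ^ ('n \<times> 'n) ^ ('n \<times> 'n)" where
  "superoperator_matrix F = matrix (\<lambda>v. flatten (F (unflatten v)))"

lemma unflatten_flatten [simp]: "unflatten (flatten X) = X"
  by (simp add: flatten_def unflatten_def vec_eq_iff)

lemma flatten_unflatten [simp]: "flatten (unflatten v) = v"
  by (simp add: flatten_def unflatten_def vec_eq_iff)

lemma inj_iff_det_superoperator_matrix:
  fixes F :: "'n::finite cmat \<Rightarrow> 'n cmat"
  assumes add: "\<And>X Y. F (X + Y) = F X + F Y" and csmult: "\<And>c X. F (csmult c X) = csmult c (F X)"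
  shows "inj F \<longleftrightarrow> det (superoperator_matrix F) \<noteq> 0"
proof -
  let ?F = "\<lambda>v. flatten (F (unflatten v))"
  have "Vector_Spaces.linear (*s) (*s) ?F"
  proof
    fix v w :: "complex ^ ('n \<times> 'n)" and c
    have "unflatten (v + w) = unflatten v + unflatten w"
      "unflatten (c *s v) = csmult c (unflatten v)"
      by (simp_all add: unflatten_def vec_eq_iff)
    then show "?F (v + w) = ?F v + ?F w" "?F (c *s v) = c *s ?F v"
      by (simp_all add: add csmult) (simp_all add: flatten_def vec_eq_iff)
  qed
  then have mult: "(*v) (superoperator_matrix F) = ?F"
    by (auto simp: superoperator_matrix_def matrix_works)
  have "inj F \<longleftrightarrow> inj ?F"
    unfolding inj_def by (metis flatten_unflatten unflatten_flatten)
  also have "\<dots> \<longleftrightarrow> invertible (superoperator_matrix F)"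
    by (simp add: invertible_left_inverse matrix_left_invertible_injective mult)
  also have "\<dots> \<longleftrightarrow> det (superoperator_matrix F) \<noteq> 0"
    by (rule invertible_det_nz)
  finally show ?thesis .
qed

lemma cpolyfun_det_superoperator_matrix:
  assumes "\<And>X. poly_matrix_fun (\<lambda>x. F x X)"
  shows "cpolyfun (\<lambda>x. det (superoperator_matrix (F x)))"
proof (rule cpolyfun_det)
  show "cpolyfun (\<lambda>x. superoperator_matrix (F x) $ i $ j)" for i j
    using assms[of "unflatten (axis j 1)"]
    by (simp add: superoperator_matrix_def matrix_def flatten_def poly_matrix_fun_iff)
qed

section \<open>Genericity\<close>

lemma (in invariant_lindblad) GAS_iff_det:
  "GAS P G \<longleftrightarrow> det (superoperator_matrix (block_compression P G)) \<noteq> 0"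
  unfolding GAS_iff_inj_compression
  by (intro inj_iff_det_superoperator_matrix linear_add[OF linear_compression] compression_csmult)

theorem theoremB1:
  fixes P :: "complex ^ 'n ^ 'n"
    and H :: "real ^ 'N \<Rightarrow> complex ^ 'n ^ 'n"
    and L :: "nat \<Rightarrow> real ^ 'N \<Rightarrow> complex ^ 'n ^ 'n"
    and M :: nat
    and xbar :: "real ^ 'N"
  assumes "orth_proj P" and "P \<noteq> 0" and "P \<noteq> mat 1"
    and "\<forall>x. hermitian (H x)"
    and "poly_matrix_fun H"
    and "\<forall>k<M. poly_matrix_fun (L k)"
    and "\<forall>x. invariant P (lindblad (H x) (\<lambda>k. L k x) M)"
    and "GAS P (lindblad (H xbar) (\<lambda>k. L k xbar) M)"
  shows "AE x in lebesgue. GAS P (lindblad (H x) (\<lambda>k. L k x) M)"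
proof -
  define G where "G = (\<lambda>x. lindblad (H x) (\<lambda>k. L k x) M)"
  define block_det where "block_det = (\<lambda>x. det (superoperator_matrix (block_compression P (G x))))"
  have GAS_iff: "GAS P (G x) \<longleftrightarrow> block_det x \<noteq> 0" for x
  proof -
    interpret invariant_lindblad "H x" "\<lambda>k. L k x" M P
      by unfold_locales (use assms in auto)
    show ?thesis
      using GAS_iff_det by (simp add: G_def block_det_def)
  qed
  have "cpolyfun block_det"
    unfolding block_det_def G_def
    by (intro cpolyfun_det_superoperator_matrix poly_matrix_fun_block_compression
        poly_matrix_fun_lindblad) (use assms in auto)
  moreover have "block_det xbar \<noteq> 0"
    using assms(8) GAS_iff by (simp add: G_def)
  ultimately have "negligible {x. block_det x = 0}"
    by (rule negligible_cpolyfun_zeros)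
  then have "negligible {x. \<not> GAS P (G x)}"
    by (simp add: GAS_iff)
  then show ?thesis
    unfolding eventually_ae_filter_negligible G_def by blast
qed

end
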